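(* Let $N=2^J$ with an integer $J>0$, and let $\mathbf{x}\in\mathbb{C}^N$ have support length $m$ (or a support length bounded by $m$), where $2^{L-1}<m\le 2^L$ with an integer $L\ge 0$. Assume $L<J-1$, and let $\mathbf{x}^{(L+1)}\in\mathbb{C}^{2^{L+1}}$ be the $2^{L+1}$-periodization of $\mathbf{x}$. Then $\mathbf{x}$ can be uniquely recovered from $\mathbf{x}^{(L+1)}$ and one nonzero component of the vector $(\widehat{x}_{2k+1})_{k=0}^{N/2-1}$ of odd-indexed Fourier values. That is: if $\mathbf{x},\mathbf{w}\in\mathbb{C}^N$ both have support length at most $m$, if $\mathbf{x}^{(L+1)}=\mathbf{w}^{(L+1)}$, and if $\widehat{x}_{2k_0+1}=\widehat{w}_{2k_0+1}\neq 0$ for some $k_0\in\{0,\dots,N/2-1\}$, then $\mathbf{x}=\mathbf{w}$.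
   Context: Vectors $\mathbf{x}=(x_k)_{k=0}^{N-1}\in\mathbb{C}^N$ are indexed from $0$ to $N-1$. Discrete Fourier transform: $\widehat{\mathbf{x}}=(\widehat{x}_k)_{k=0}^{N-1}=\mathbf{F}_N\mathbf{x}$ with $\mathbf{F}_N=(\omega_N^{jk})_{j,k=0}^{N-1}$ and $\omega_N=e^{-2\pi i/N}$. Support length: the support length of $\mathbf{x}\in\mathbb{C}^N$ is the minimal integer $m$ for which there exists $\mu\in\{0,\dots,N-1\}$ such that $x_k=0$ for all $k\notin\{(\mu+r)\bmod N:\ r=0,\dots,m-1\}$ (a cyclic interval; zeros inside the interval are allowed). Periodization: for $N=2^J$ and $0\le j\le J$, the $2^j$-periodization of $\mathbf{x}$ is $\mathbf{x}^{(j)}=(x^{(j)}_k)_{k=0}^{2^j-1}\in\mathbb{C}^{2^j}$ with $x^{(j)}_k=\sum_{\ell=0}^{2^{J-j}-1}x_{k+2^j\ell}$. The bound $m$ on the support length is known a priori, so "uniquely recovered" refers to uniqueness within the class of vectors of support length at most $m$; the index of the nonzero Fourier component used is also known. *)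

theory Defs
  imports Complex_Main "Jordan_Normal_Form.Matrix"
begin

definition omega :: "nat \<Rightarrow> complex" where
  "omega N = exp (- 2 * of_real pi * \<i> / of_nat N)"

definition fourier_mat :: "nat \<Rightarrow> complex mat" where
  "fourier_mat N = mat N N (\<lambda>(j, k). omega N ^ (j * k))"

definition dft :: "complex vec \<Rightarrow> complex vec" where
  "dft x = fourier_mat (dim_vec x) *\<^sub>v x"

definition cyclic_interval :: "nat \<Rightarrow> nat \<Rightarrow> nat \<Rightarrow> nat set" where
  "cyclic_interval N \<mu> m = {(\<mu> + r) mod N | r. r < m}"

text \<open>Entries inside the interval may vanish; the zero vector has support length \<open>0\<close>.
  The set of admissible \<open>m\<close> contains \<open>dim_vec x\<close> as soon as \<open>dim_vec x > 0\<close>.\<close>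

definition support_length :: "complex vec \<Rightarrow> nat" where
  "support_length x =
    (LEAST m. \<exists>\<mu> < dim_vec x. \<forall>k < dim_vec x.
       k \<notin> cyclic_interval (dim_vec x) \<mu> m \<longrightarrow> x $ k = 0)"

text \<open>For \<open>x\<close> of dimension \<open>2 ^ J\<close> and \<open>j \<le> J\<close>.\<close>

definition periodization :: "nat \<Rightarrow> nat \<Rightarrow> complex vec \<Rightarrow> complex vec" where
  "periodization J j x = vec (2 ^ j) (\<lambda>k. \<Sum>l < 2 ^ (J - j). x $ (k + 2 ^ j * l))"

end

theory Submission
  imports Defs
begin

text \<open>Let \<open>M = 2 ^ (L + 1)\<close>. The support of \<open>x\<close> lies in a cyclic interval of length at most
  \<open>M / 2\<close>, so folding modulo \<open>M\<close> is injective on it, and the difference of any two of its points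
  lies strictly between \<open>- M / 2\<close> and \<open>M / 2\<close>, hence is determined by its residue modulo \<open>M\<close>.
  Two such vectors with the same nonzero periodization are therefore cyclic shifts of each other,
  say by \<open>s\<close>. A shift by \<open>s\<close> multiplies the \<open>k\<close>-th Fourier value by \<open>\<omega> ^ (k * s)\<close>; if \<open>k\<close> is odd
  and the value is nonzero and unchanged, then \<open>2 ^ J\<close> divides \<open>s\<close>.\<close>

section \<open>Periodic extensions to the integers\<close>

text \<open>With all integers as indices, a cyclic interval becomes an ordinary interval and a
  cyclic shift becomes a translation by an integer of either sign.\<close>

definition periodic_ext :: "'a vec \<Rightarrow> int \<Rightarrow> 'a" where
  "periodic_ext x i = x $ nat (i mod int (dim_vec x))"

lemma periodic_ext_cong:
  "i mod int (dim_vec x) = j mod int (dim_vec x) \<Longrightarrow> periodic_ext x i = periodic_ext x j"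
  by (simp add: periodic_ext_def)

lemma periodic_ext_mod [simp]: "periodic_ext x (i mod int (dim_vec x)) = periodic_ext x i"
  by (simp add: periodic_ext_def)

lemma periodic_ext_of_nat: "k < dim_vec x \<Longrightarrow> periodic_ext x (int k) = x $ k"
  by (simp add: periodic_ext_def)

lemma sum_periodic_shift:
  fixes f :: "int \<Rightarrow> 'a :: comm_monoid_add"
  assumes "N > 0" and period: "\<And>i. f (i mod N) = f i"
  shows "(\<Sum>i\<in>{0..<N}. f (i + s)) = (\<Sum>i\<in>{0..<N}. f i)"
proof (rule sum.reindex_bij_witness[where i = "\<lambda>i. (i - s) mod N" and j = "\<lambda>i. (i + s) mod N"])
  fix i assume "i \<in> {0..<N}"
  then show "((i + s) mod N - s) mod N = i" and "((i - s) mod N + s) mod N = i"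
    by (simp_all add: mod_simps)
  show "f ((i + s) mod N) = f (i + s)"
    by (rule period)
qed (use \<open>N > 0\<close> in auto)

lemma support_interval:
  assumes "dim_vec x > 0" and "support_length x \<le> m"
  obtains \<mu> :: int where "\<And>i. periodic_ext x i \<noteq> 0 \<Longrightarrow> (i - \<mu>) mod int (dim_vec x) < int m"
proof -
  define N where "N = dim_vec x"
  let ?P = "\<lambda>m. \<exists>\<mu><N. \<forall>k<N. k \<notin> cyclic_interval N \<mu> m \<longrightarrow> x $ k = 0"
  \<comment> \<open>The full length \<open>N\<close> is admissible, so the least admissible length
    is attained.\<close>
  have "?P N"
    using assms(1) by (intro exI[of _ 0]) (auto simp: cyclic_interval_def N_def intro: mod_less[symmetric])
  then have "?P (support_length x)"
    unfolding support_length_def N_def by (rule LeastI)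
  then obtain \<mu> where \<mu>: "\<And>k. k < N \<Longrightarrow> k \<notin> cyclic_interval N \<mu> (support_length x) \<Longrightarrow> x $ k = 0"
    by blast
  have "(i - int \<mu>) mod int N < int m" if "periodic_ext x i \<noteq> 0" for i
  proof -
    define k where "k = nat (i mod int N)"
    have k: "k < N" "int k = i mod int N"
      using assms(1) by (simp_all add: k_def N_def nat_less_iff)
    have "x $ k \<noteq> 0"
      using that by (simp add: k_def periodic_ext_def N_def)
    with \<mu> k obtain r where r: "r < support_length x" "k = (\<mu> + r) mod N"
      unfolding cyclic_interval_def by blast
    have "(i - int \<mu>) mod int N = (int k - int \<mu>) mod int N"
      by (simp add: k mod_simps)
    also have "\<dots> = int r mod int N"
      by (simp add: r zmod_int mod_simps)
    also have "\<dots> \<le> int r"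
      by (simp add: zmod_le_nonneg_dividend)
    finally show ?thesis
      using r(1) assms(2) by linarith
  qed
  then show thesis
    unfolding N_def by (rule that)
qed

section \<open>Periodization of vectors with short support\<close>

text \<open>Each residue class modulo \<open>2 ^ j\<close> meets the window of \<open>2 ^ j\<close>
  integers starting at \<open>\<mu>\<close> exactly once. Modulo \<open>2 ^ J\<close> the support
  lies in that window, so at most one summand of the folded entry can be nonzero, namely the one at
  \<open>i\<close>.\<close>

lemma periodization_nth_eq:
  assumes dim: "dim_vec x = 2 ^ J" and "j \<le> J"
    and supp: "\<And>i. periodic_ext x i \<noteq> 0 \<Longrightarrow> (i - \<mu>) mod 2 ^ J < 2 ^ j"
    and i: "\<mu> \<le> i" "i < \<mu> + 2 ^ j"
  shows "periodization J j x $ nat (i mod 2 ^ j) = periodic_ext x i"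
proof -
  define M :: int where "M = 2 ^ j"
  define N :: int where "N = 2 ^ J"
  have pos: "M > 0" "N > 0" by (simp_all add: M_def N_def)
  have "M dvd N" and NM: "N = M * 2 ^ (J - j)"
    using \<open>j \<le> J\<close> by (simp_all add: M_def N_def le_imp_power_dvd flip: power_add)
  have dimN: "int (dim_vec x) = N" by (simp add: dim N_def)
  define k where "k = nat (i mod M)"
  have k: "int k = i mod M" "k < 2 ^ j"
    using pos by (simp_all add: k_def nat_less_iff M_def)
  \<comment> \<open>\<open>l0\<close> is the number of the summand belonging to \<open>i\<close>:
    \<open>i mod N\<close> is \<open>k + M * l0\<close>.\<close>
  define l0 where "l0 = nat (i mod N div M)"
  have "M * (i mod N div M) \<le> i mod N"
    using pos minus_mod_eq_mult_div[of "i mod N" M] pos_mod_sign[of M "i mod N"] by linarith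
  also have "\<dots> < M * 2 ^ (J - j)"
    using pos by (simp flip: NM)
  finally have "i mod N div M < 2 ^ (J - j)"
    using pos by simp
  then have l0: "int l0 = i mod N div M" "l0 < 2 ^ (J - j)"
    using pos by (simp_all add: l0_def nat_less_iff pos_imp_zdiv_nonneg_iff)
  have idx: "int (k + 2 ^ j * l) = int k + M * int l" for l
    by (simp add: M_def)
  have bound: "k + 2 ^ j * l < dim_vec x" if "l < 2 ^ (J - j)" for l
  proof -
    have "k + 2 ^ j * l < 2 ^ j * (l + 1)"
      using k(2) by simp
    also have "\<dots> \<le> 2 ^ j * 2 ^ (J - j)"
      using that by (intro mult_left_mono) auto
    finally show ?thesis
      using \<open>j \<le> J\<close> by (simp add: dim flip: power_add)
  qed
  have "i mod M = i mod N mod M"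
    using \<open>M dvd N\<close> by (simp add: mod_mod_cancel)
  then have l0_idx: "int k + M * int l0 = i mod N"
    by (simp add: k l0)
  have vanish: "x $ (k + 2 ^ j * l) = 0" if "l < 2 ^ (J - j)" "l \<noteq> l0" for l
  proof (rule ccontr)
    assume "x $ (k + 2 ^ j * l) \<noteq> 0"
    then have "periodic_ext x (int k + M * int l) \<noteq> 0"
      using periodic_ext_of_nat[OF bound[OF that(1)]] by (simp only: idx) simp
    then have less: "(int k + M * int l - \<mu>) mod N < M"
      using supp by (simp add: M_def N_def)
    \<comment> \<open>The offset from \<open>\<mu>\<close> is below \<open>M\<close>, so it is
      determined by its residue modulo \<open>M\<close>, which is that of \<open>i - \<mu>\<close>.
      Hence this index and \<open>i\<close> agree modulo \<open>N\<close>.\<close>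
    have "(int k + M * int l - \<mu>) mod N = (int k + M * int l - \<mu>) mod N mod M"
      using less pos by simp
    also have "\<dots> = (int k + M * int l - \<mu>) mod M"
      using \<open>M dvd N\<close> by (simp add: mod_mod_cancel)
    also have "\<dots> = (i - \<mu>) mod M"
      by (simp add: k mod_simps) (metis mod_diff_left_eq mod_mult_self2 mod_mod_trivial)
    also have "\<dots> = i - \<mu>"
      using i by (simp add: M_def)
    finally have "(int k + M * int l) mod N = i mod N"
      by (metis diff_add_cancel mod_add_left_eq)
    moreover have "(int k + M * int l) mod N = int k + M * int l"
      using bound[OF that(1)] dimN idx[of l] pos by (metis mod_pos_pos_trivial of_nat_0_le_iff of_nat_less_iff)
    ultimately have "M * int l = M * int l0"
      using l0_idx by linarith
    then show False
      using that(2) pos by simp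
  qed
  have "periodization J j x $ nat (i mod 2 ^ j) = (\<Sum>l < 2 ^ (J - j). x $ (k + 2 ^ j * l))"
    using k(2) by (simp add: periodization_def k_def M_def)
  also have "\<dots> = (\<Sum>l\<in>{l0}. x $ (k + 2 ^ j * l))"
    using l0(2) vanish by (intro sum.mono_neutral_right) auto
  also have "\<dots> = periodic_ext x (i mod N)"
    using periodic_ext_of_nat[OF bound[OF l0(2)]] by (simp only: idx l0_idx) simp
  also have "\<dots> = periodic_ext x i"
    using periodic_ext_mod[of x i] by (simp add: dimN)
  finally show ?thesis .
qed

text \<open>An entry of the common periodization is read off once from \<open>x\<close> and once
  from \<open>w\<close>. The two positions are congruent modulo \<open>2 ^ (L + 1)\<close>; that
  they differ by exactly \<open>q - p\<close> follows because both supports fill at most half of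
  their windows.\<close>

lemma shift_on_support:
  assumes dim: "dim_vec x = 2 ^ J" "dim_vec w = 2 ^ J" and "L + 1 \<le> J"
    and supp_x: "\<And>i. periodic_ext x i \<noteq> 0 \<Longrightarrow> (i - \<mu>) mod 2 ^ J < 2 ^ L"
    and supp_w: "\<And>i. periodic_ext w i \<noteq> 0 \<Longrightarrow> (i - \<nu>) mod 2 ^ J < 2 ^ L"
    and per: "periodization J (L + 1) x = periodization J (L + 1) w"
    and p: "\<mu> \<le> p" "p < \<mu> + 2 ^ L" and q: "\<nu> \<le> q" "q < \<nu> + 2 ^ L"
    and cong: "q mod 2 ^ (L + 1) = p mod 2 ^ (L + 1)"
    and nz: "periodic_ext x i \<noteq> 0"
  shows "periodic_ext w (i + (q - p)) = periodic_ext x i"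
proof -
  define H :: int where "H = 2 ^ L"
  have H: "H > 0" "(2::int) ^ (L + 1) = 2 * H" by (simp_all add: H_def)
  define N :: int where "N = 2 ^ J"
  have "N > 0" by (simp add: N_def)
  have "2 * H dvd N"
    unfolding N_def H(2)[symmetric] using \<open>L + 1 \<le> J\<close> by (rule le_imp_power_dvd)
  then have "2 * H \<le> N"
    using \<open>N > 0\<close> by (rule zdvd_imp_le)
  have dimN: "int (dim_vec x) = N" "int (dim_vec w) = N" by (simp_all add: dim N_def)
  have eval_x: "periodization J (L + 1) x $ nat (t mod (2 * H)) = periodic_ext x t"
    if "\<mu> \<le> t" "t < \<mu> + 2 * H" for t
    using periodization_nth_eq[OF dim(1) \<open>L + 1 \<le> J\<close>, of \<mu> t] supp_x that H
    by (fastforce simp: H_def)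
  \<comment> \<open>By \<open>per\<close>, the periodization of \<open>x\<close> also evaluates
    \<open>w\<close>, but on the window starting at \<open>\<nu>\<close>.\<close>
  have eval_w: "periodization J (L + 1) x $ nat (t mod (2 * H)) = periodic_ext w t"
    if "\<nu> \<le> t" "t < \<nu> + 2 * H" for t
    using periodization_nth_eq[OF dim(2) \<open>L + 1 \<le> J\<close>, of \<nu> t] supp_w that H per
    by (fastforce simp: H_def)
  define i' where "i' = \<mu> + (i - \<mu>) mod N"
  have i'_mod: "i' mod N = i mod N"
    by (simp add: i'_def mod_simps)
  have i': "\<mu> \<le> i'" "i' < \<mu> + H"
    using supp_x[OF nz] \<open>N > 0\<close> by (simp_all add: i'_def N_def H_def)
  have x_i': "periodic_ext x i' = periodic_ext x i"
    using i'_mod by (intro periodic_ext_cong) (simp add: dimN)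
  define t where "t = i' + (q - p)"
  have t_mod: "t mod (2 * H) = i' mod (2 * H)"
    using cong unfolding t_def H by (metis add.right_neutral mod_0 mod_add_right_eq mod_eq_dvd_iff dvd_imp_mod_0)
  have x_val: "periodization J (L + 1) x $ nat (t mod (2 * H)) = periodic_ext x i"
    using eval_x[of i'] i' H t_mod x_i' by simp
  have "\<nu> \<le> t"
  proof (rule ccontr)
    \<comment> \<open>Since \<open>i' - p > - H\<close> and \<open>q \<ge> \<nu>\<close>, the point
      \<open>t + 2 * H\<close> would fall into the upper half of the window at \<open>\<nu>\<close>,
      where \<open>w\<close> vanishes, and yet carry the nonzero value of \<open>x\<close> at
      \<open>i\<close>.\<close>
    assume less: "\<not> \<nu> \<le> t"
    have range: "\<nu> + H \<le> t + 2 * H" "t + 2 * H < \<nu> + 2 * H"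
      using less i' p q by (simp_all add: t_def H_def)
    then have "periodic_ext w (t + 2 * H) = periodic_ext x i"
      using eval_w[of "t + 2 * H"] x_val H by simp
    then have "(t + 2 * H - \<nu>) mod N < H"
      using supp_w nz by (simp add: N_def H_def)
    moreover have "(t + 2 * H - \<nu>) mod N = t + 2 * H - \<nu>"
      using range H \<open>2 * H \<le> N\<close> by (intro mod_pos_pos_trivial) auto
    ultimately show False
      using range by simp
  qed
  moreover have "t < \<nu> + 2 * H"
    using i' p q by (simp add: t_def H_def)
  ultimately have "periodic_ext w t = periodic_ext x i"
    using eval_w x_val by simp
  moreover have "periodic_ext w t = periodic_ext w (i + (q - p))"
    using i'_mod unfolding t_def by (intro periodic_ext_cong) (metis dimN(2) mod_add_left_eq)
  ultimately show ?thesis by simp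
qed

text \<open>One nonzero entry of \<open>x\<close> already fixes the shift: it must move that entry
  to the point of the support interval of \<open>w\<close> with the same residue modulo
  \<open>2 ^ (L + 1)\<close>.\<close>

lemma periodization_eq_imp_shift:
  assumes dim: "dim_vec x = 2 ^ J" "dim_vec w = 2 ^ J" and "L + 1 \<le> J"
    and len: "support_length x \<le> 2 ^ L" "support_length w \<le> 2 ^ L"
    and per: "periodization J (L + 1) x = periodization J (L + 1) w"
    and nz: "periodic_ext x i0 \<noteq> 0"
  obtains s where "\<And>i. periodic_ext w (i + s) = periodic_ext x i"
proof -
  obtain \<mu> where supp_x: "\<And>i. periodic_ext x i \<noteq> 0 \<Longrightarrow> (i - \<mu>) mod 2 ^ J < 2 ^ L"
    using support_interval[of x "2 ^ L"] len dim by auto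
  obtain \<nu> where supp_w: "\<And>i. periodic_ext w i \<noteq> 0 \<Longrightarrow> (i - \<nu>) mod 2 ^ J < 2 ^ L"
    using support_interval[of w "2 ^ L"] len dim by auto
  define M :: int where "M = 2 ^ (L + 1)"
  define N :: int where "N = 2 ^ J"
  have pos: "M > 0" "N > 0" and half: "2 ^ L < M"
    by (simp_all add: M_def N_def)
  have "M \<le> N"
    using \<open>L + 1 \<le> J\<close> unfolding M_def N_def by (intro power_increasing) auto
  define p where "p = \<mu> + (i0 - \<mu>) mod N"
  have p: "\<mu> \<le> p" "p < \<mu> + 2 ^ L"
    using supp_x[OF nz] pos by (simp_all add: p_def N_def)
  have x_p: "periodic_ext x p \<noteq> 0"
    using nz periodic_ext_cong[of p x i0] by (simp add: p_def dim N_def mod_simps)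
  \<comment> \<open>\<open>q\<close> is the point congruent to \<open>p\<close> in the window of
    length \<open>M\<close> at \<open>\<nu>\<close>. The nonzero value of \<open>w\<close> there
    will place it in the lower half.\<close>
  define q where "q = \<nu> + (p - \<nu>) mod M"
  have q_range: "\<nu> \<le> q" "q < \<nu> + M"
    using pos by (simp_all add: q_def)
  have cong: "q mod M = p mod M"
    by (simp add: q_def mod_simps)
  have "periodic_ext w q = periodization J (L + 1) w $ nat (q mod M)"
    using periodization_nth_eq[OF dim(2) \<open>L + 1 \<le> J\<close>, of \<nu> q] supp_w q_range half
    by (fastforce simp: M_def)
  also have "\<dots> = periodic_ext x p"
    using periodization_nth_eq[OF dim(1) \<open>L + 1 \<le> J\<close>, of \<mu> p] supp_x p half cong per
    by (fastforce simp: M_def)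
  finally have "periodic_ext w q \<noteq> 0"
    using x_p by simp
  then have "(q - \<nu>) mod N < 2 ^ L"
    using supp_w by (simp add: N_def)
  then have q: "\<nu> \<le> q" "q < \<nu> + 2 ^ L"
    using q_range \<open>M \<le> N\<close> by simp_all
  have fwd: "periodic_ext w (i + (q - p)) = periodic_ext x i" if "periodic_ext x i \<noteq> 0" for i
    by (rule shift_on_support[OF dim \<open>L + 1 \<le> J\<close> supp_x supp_w per p q cong[unfolded M_def] that])
  \<comment> \<open>The same argument with \<open>x\<close> and \<open>w\<close> exchanged is what
    carries zeros of \<open>x\<close> to zeros of \<open>w\<close>.\<close>
  have bwd: "periodic_ext x (i + (p - q)) = periodic_ext w i" if "periodic_ext w i \<noteq> 0" for i
    by (rule shift_on_support[OF dim(2,1) \<open>L + 1 \<le> J\<close> supp_w supp_x per[symmetric] q p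
          cong[unfolded M_def, symmetric] that])
  have "periodic_ext w (i + (q - p)) = periodic_ext x i" for i
    using fwd[of i] bwd[of "i + (q - p)"] by (cases "periodic_ext x i = 0") auto
  then show thesis by (rule that)
qed

section \<open>The Fourier transform of a shift\<close>

lemma omega_power_int: "omega N powi n = cis (- 2 * pi * of_int n / of_nat N)"
  unfolding omega_def by (simp add: cis_conv_exp exp_power_int mult_ac)

lemma cis_eq_1_iff: "cis t = 1 \<longleftrightarrow> (\<exists>k::int. t = of_int k * 2 * pi)"
proof -
  have "cis t = 1 \<longleftrightarrow> cos t = 1"
    by (auto simp: complex_eq_iff cos_one_sin_zero)
  then show ?thesis
    by (simp add: cos_one_2pi_int)
qed

text \<open>This is the primitivity of the root of unity \<open>omega N\<close>, obtained by
  comparing angles modulo a full turn.\<close>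

lemma omega_power_int_eq_1_iff:
  assumes "N > 0"
  shows "omega N powi n = 1 \<longleftrightarrow> int N dvd n"
proof -
  have "omega N powi n = 1 \<longleftrightarrow> (\<exists>k::int. - 2 * pi * of_int n / of_nat N = of_int k * 2 * pi)"
    unfolding omega_power_int by (rule cis_eq_1_iff)
  also have "\<dots> \<longleftrightarrow> (\<exists>k::int. pi * real_of_int n = pi * real_of_int (int N * - k))"
    using assms by (intro ex_cong1) (auto simp: field_simps)
  also have "\<dots> \<longleftrightarrow> (\<exists>k::int. n = int N * - k)"
    by (simp only: mult_left_cancel[OF pi_neq_zero] of_int_eq_iff)
  also have "\<dots> \<longleftrightarrow> int N dvd n"
    by (metis dvd_def minus_minus)
  finally show ?thesis .
qed

text \<open>Integer indices and integer powers allow the sum to be translated by a possibly negative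
  amount.\<close>

lemma dft_nth:
  assumes "k < dim_vec x"
  shows "dft x $ k =
    (\<Sum>i\<in>{0..<int (dim_vec x)}. omega (dim_vec x) powi (int k * i) * periodic_ext x i)"
proof -
  let ?N = "dim_vec x"
  have "dft x $ k = (\<Sum>j\<in>{0..<?N}. omega ?N ^ (k * j) * x $ j)"
    using assms by (simp add: dft_def fourier_mat_def scalar_prod_def)
  also have "\<dots> = (\<Sum>j\<in>{0..<?N}. omega ?N powi (int k * int j) * periodic_ext x (int j))"
    by (intro sum.cong)
      (auto simp: periodic_ext_of_nat power_int_of_nat simp flip: of_nat_mult)
  also have "\<dots> = (\<Sum>i\<in>int ` {0..<?N}. omega ?N powi (int k * i) * periodic_ext x i)"
    by (subst sum.reindex) (auto simp: inj_on_def)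
  finally show ?thesis
    by (simp add: image_int_atLeastLessThan)
qed

text \<open>The summand is periodic in \<open>i\<close> with period \<open>dim_vec x\<close>, so
  \<open>i\<close> may be replaced by \<open>i + s\<close>; the factor depending on \<open>s\<close>
  then splits off.\<close>

lemma dft_shift:
  assumes dim: "dim_vec w = dim_vec x" and "k < dim_vec x"
    and shift: "\<And>i. periodic_ext w (i + s) = periodic_ext x i"
  shows "dft w $ k = omega (dim_vec x) powi (int k * s) * dft x $ k"
proof -
  let ?N = "dim_vec x" and ?f = "\<lambda>i. omega (dim_vec x) powi (int k * i) * periodic_ext w i"
  have "?N > 0" using \<open>k < ?N\<close> by simp
  have nz: "omega ?N \<noteq> 0" by (simp add: omega_def)
  have period: "?f (i mod int ?N) = ?f i" for i
  proof -
    \<comment> \<open>The exponent is split along \<open>i = i mod N + N * (i div N)\<close>; the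
      second factor is a power of \<open>omega N ^ N\<close>, hence 1.\<close>
    have "omega ?N powi (int k * i) =
        omega ?N powi (int k * (i mod int ?N)) * omega ?N powi (int ?N * (int k * (i div int ?N)))"
      using nz by (simp add: flip: power_int_add)
        (metis add.commute distrib_left mult.left_commute mult_div_mod_eq)
    moreover have "omega ?N powi (int ?N * (int k * (i div int ?N))) = 1"
      using \<open>?N > 0\<close> by (simp add: omega_power_int_eq_1_iff)
    ultimately show ?thesis
      using periodic_ext_mod[of w i] dim by simp
  qed
  have "dft w $ k = (\<Sum>i\<in>{0..<int ?N}. ?f i)"
    using assms(2) by (simp add: dft_nth dim)
  also have "\<dots> = (\<Sum>i\<in>{0..<int ?N}. ?f (i + s))"
    using \<open>?N > 0\<close> period by (intro sum_periodic_shift[symmetric]) auto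
  also have "\<dots> = omega ?N powi (int k * s) * dft x $ k"
    using assms(2) nz
    by (simp add: dft_nth shift sum_distrib_left distrib_left power_int_add mult_ac)
  finally show ?thesis .
qed

section \<open>Uniqueness from the periodization and one odd-indexed Fourier value\<close>

theorem theorem3p1:
  fixes J L m N k0 :: nat and x w :: "complex vec"
  assumes "J > 0" and "N = 2 ^ J"
    and "(2::real) powi (int L - 1) < real m" and "m \<le> 2 ^ L"
    and "int L < int J - 1"
    and "x \<in> carrier_vec N" and "w \<in> carrier_vec N"
    and "support_length x \<le> m" and "support_length w \<le> m"
    and "periodization J (L + 1) x = periodization J (L + 1) w"
    and "k0 < N div 2"
    and "dft x $ (2 * k0 + 1) = dft w $ (2 * k0 + 1)"
    and "dft x $ (2 * k0 + 1) \<noteq> 0"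
  shows "x = w"
proof -
  let ?k = "2 * k0 + 1"
  have dim: "dim_vec x = N" "dim_vec w = N"
    using assms(6,7) by auto
  have "?k < N"
    using \<open>k0 < N div 2\<close> by linarith
  then have "?k < dim_vec x" by (simp add: dim)
  \<comment> \<open>A nonzero Fourier value excludes the zero vector, whose periodization would fix
    no shift.\<close>
  have "\<exists>i0. periodic_ext x i0 \<noteq> 0"
  proof (rule ccontr)
    assume "\<nexists>i0. periodic_ext x i0 \<noteq> 0"
    then show False
      using dft_nth[OF \<open>?k < dim_vec x\<close>] assms(13) by simp
  qed
  then obtain i0 where nz: "periodic_ext x i0 \<noteq> 0" by blast
  have "L + 1 \<le> J"
    using assms(5) by simp
  have len: "support_length x \<le> 2 ^ L" "support_length w \<le> 2 ^ L"
    using assms(4,8,9) by simp_all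
  obtain s where s: "\<And>i. periodic_ext w (i + s) = periodic_ext x i"
    using periodization_eq_imp_shift[OF _ _ \<open>L + 1 \<le> J\<close> len assms(10) nz] dim assms(2) by metis
  \<comment> \<open>The common Fourier value is nonzero and can be cancelled.\<close>
  have "omega N powi (int ?k * s) = 1"
    using dft_shift[OF _ \<open>?k < dim_vec x\<close> s] dim assms(12,13) by simp
  then have "int N dvd int ?k * s"
    using \<open>?k < N\<close> by (subst (asm) omega_power_int_eq_1_iff) auto
  \<comment> \<open>Here the odd index enters: it is coprime to the power of two \<open>N\<close>,
    so the shift is trivial modulo \<open>N\<close>.\<close>
  moreover have "coprime (int N) (int ?k)"
    by (simp add: assms(2))
  ultimately have "int N dvd s"
    by (simp add: coprime_dvd_mult_right_iff)
  show "x = w"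
  proof (rule eq_vecI)
    fix i assume "i < dim_vec w"
    then have "x $ i = periodic_ext w (int i + s)"
      using dim by (simp add: s periodic_ext_of_nat)
    also have "\<dots> = periodic_ext w (int i)"
      using \<open>int N dvd s\<close> dim by (intro periodic_ext_cong) (auto elim!: dvdE)
    also have "\<dots> = w $ i"
      using \<open>i < dim_vec w\<close> by (rule periodic_ext_of_nat)
    finally show "x $ i = w $ i" .
  qed (simp add: dim)
qed

end
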